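(* Let $F$ be a Boolean circuit, let $(T,\mathbf{G})$ be a type-respecting simplified clique decomposition of $F$ of width $k$, and let $F^*$ be the circuit constructed from $F$ and $(T,\mathbf{G})$ as described in the context. Then there is a tree decomposition of (the undirected graph underlying the DAG of) $F^*$ with at most $2|F|$ bags and width at most $3k+2$.
   Context: Boolean circuits are over $\{\vee,\wedge,\neg\}$ (input gates, NOT gates with one input, AND/OR gates with positive fan-in; no constant gates); $|F|$ is the number of gates. A labeled directed graph is $(V,E,\mathbf{S})$ with $\mathbf{S}$ a partition of $V$ into labels. A simplified clique decomposition (SCD) $(T,\mathbf{G})$: rooted tree $T$, every node with at most two children, node $t$ carrying labeled directed graph $G(t)$; leaf: $(\{v\},\emptyset,\{\{v\}\})$; two children: union of their vertex-disjoint graphs; one child $t_1$: $G(t_1)$ modified by (i) adding a new vertex as singleton label, (ii) union of labels $S_1,S_2$ into $S$ ($S_1,S_2$ are the children of $S$), or (iii) adding all arcs from label $S_1$ to label $S_2$ ("an arc from $S_1$ to $S_2$"). Labels of $(T,\mathbf{G})$: $\bigcup_t\mathbf{S}(G(t))$; width: $\max_t|\mathbf{S}(G(t))|$; it is an SCD of $F$ if the unlabeled root graph is the DAG of $F$; type-respecting: every non-singleton label is unary (input and NOT gates only), AND (AND gates only) or OR (OR gates only); singleton labels take the type of their gate. Construction of $F^*$: singleton label $\{g\}$ is associated with original gate $g$, with $oand=oor=in=g$; each non-singleton label $S$ gets new gates $oand(S)$ (AND) and $oor(S)$ (OR), and if $S$ contains no input gates a gate $in(S)$ (AND gate for AND labels,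 OR gate for OR labels, a chain of two NOT gates for unary labels). Wires: if $S_1$ is a child of $S_2$, wires $oand(S_1)\to oand(S_2)$ and $oor(S_1)\to oor(S_2)$, and if moreover $S_2$ has no input gates, $in(S_2)\to in(S_1)$; if there is an arc from $S_1$ to $S_2$: $oand(S_1)\to in(S_2)$ if $S_2$ is an AND label, $oor(S_1)\to in(S_2)$ if $S_2$ is an OR label, and one arbitrary of $oand(S_1),oor(S_1)$ to $in(S_2)$ if $S_2$ is a unary label of NOT gates only. Then $in(S)$ gates without inputs are removed iteratively. The treewidth of a circuit is that of the undirected graph underlying its DAG. *)

theory Defs
  imports Main "HOL-Library.Disjoint_Sets" "Graph_Theory.Digraph_Component"
begin

section \<open>Boolean circuits\<close>

datatype 'v gate_kind = InputG 'v | NotG | AndG | OrG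

record ('a, 'v) circuit =
  dag :: "'a pair_pre_digraph"
  kind :: "'a \<Rightarrow> 'v gate_kind"

definition is_input :: "('a, 'v) circuit \<Rightarrow> 'a \<Rightarrow> bool" where
  "is_input F g \<longleftrightarrow> (\<exists>x. kind F g = InputG x)"

definition boolean_circuit :: "('a, 'v) circuit \<Rightarrow> bool" where
  "boolean_circuit F \<longleftrightarrow>
     pair_fin_digraph (dag F) \<and> acyclic (parcs (dag F)) \<and>
     (\<forall>g \<in> pverts (dag F).
        case kind F g of
          InputG x \<Rightarrow> in_degree (with_proj (dag F)) g = 0
        | NotG \<Rightarrow> in_degree (with_proj (dag F)) g = 1
        | AndG \<Rightarrow> in_degree (with_proj (dag F)) g > 0
        | OrG \<Rightarrow> in_degree (with_proj (dag F)) g > 0)"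

definition circuit_size :: "('a, 'v) circuit \<Rightarrow> nat" where
  "circuit_size F = card (pverts (dag F))"


section \<open>Simplified clique decompositions\<close>

record 'a labeled_digraph =
  unlabeled :: "'a pair_pre_digraph"
  labels :: "'a set set"

definition wf_labeled_digraph :: "'a labeled_digraph \<Rightarrow> bool" where
  "wf_labeled_digraph H \<longleftrightarrow>
     pair_fin_digraph (unlabeled H) \<and> partition_on (pverts (unlabeled H)) (labels H)"

text \<open>
  The rooted tree of a decomposition, where every node records the operation performed at it.
  The labeled digraph carried by a node is determined by the subtree rooted there
  (\<open>node_graph\<close>). Recording the operation keeps \<open>AddArcs S1 S2\<close> meaningful even when
  it does not change the graph because all these arcs are already present.
\<close>

datatype 'a scd =
    Leaf 'a
  | Join "'a scd" "'a scd"
  | AddVertex 'a "'a scd"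
  | UniteLabels "'a set" "'a set" "'a scd"
  | AddArcs "'a set" "'a set" "'a scd"

fun node_graph :: "'a scd \<Rightarrow> 'a labeled_digraph" where
  "node_graph (Leaf v) =
     \<lparr> unlabeled = \<lparr> pverts = {v}, parcs = {} \<rparr>, labels = {{v}} \<rparr>"
| "node_graph (Join t1 t2) =
     \<lparr> unlabeled =
         \<lparr> pverts = pverts (unlabeled (node_graph t1)) \<union> pverts (unlabeled (node_graph t2)),
           parcs = parcs (unlabeled (node_graph t1)) \<union> parcs (unlabeled (node_graph t2)) \<rparr>,
       labels = labels (node_graph t1) \<union> labels (node_graph t2) \<rparr>"
| "node_graph (AddVertex v t1) =
     \<lparr> unlabeled =
         \<lparr> pverts = insert v (pverts (unlabeled (node_graph t1))),
           parcs = parcs (unlabeled (node_graph t1)) \<rparr>,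
       labels = insert {v} (labels (node_graph t1)) \<rparr>"
| "node_graph (UniteLabels S1 S2 t1) =
     \<lparr> unlabeled = unlabeled (node_graph t1),
       labels = insert (S1 \<union> S2) (labels (node_graph t1) - {S1, S2}) \<rparr>"
| "node_graph (AddArcs S1 S2 t1) =
     \<lparr> unlabeled =
         \<lparr> pverts = pverts (unlabeled (node_graph t1)),
           parcs = parcs (unlabeled (node_graph t1)) \<union> S1 \<times> S2 \<rparr>,
       labels = labels (node_graph t1) \<rparr>"

fun is_scd :: "'a scd \<Rightarrow> bool" where
  "is_scd (Leaf v) \<longleftrightarrow> True"
| "is_scd (Join t1 t2) \<longleftrightarrow>
     is_scd t1 \<and> is_scd t2 \<and>
     pverts (unlabeled (node_graph t1)) \<inter> pverts (unlabeled (node_graph t2)) = {}"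
| "is_scd (AddVertex v t1) \<longleftrightarrow>
     is_scd t1 \<and> v \<notin> pverts (unlabeled (node_graph t1))"
| "is_scd (UniteLabels S1 S2 t1) \<longleftrightarrow>
     is_scd t1 \<and> S1 \<in> labels (node_graph t1) \<and> S2 \<in> labels (node_graph t1) \<and> S1 \<noteq> S2"
| "is_scd (AddArcs S1 S2 t1) \<longleftrightarrow>
     is_scd t1 \<and> S1 \<in> labels (node_graph t1) \<and> S2 \<in> labels (node_graph t1)"

lemma partition_on_disjoint_Un:
  assumes "partition_on A P" "partition_on B Q" "A \<inter> B = {}"
  shows "partition_on (A \<union> B) (P \<union> Q)"
proof -
  have "\<Union> P \<inter> \<Union> Q = {}"
    using assms(3) by (simp flip: partition_onD1[OF assms(1)] partition_onD1[OF assms(2)])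
  then have "disjoint (P \<union> Q)"
    by (rule disjoint_union[OF partition_onD2[OF assms(1)] partition_onD2[OF assms(2)]])
  then show ?thesis
    using partition_onD1[OF assms(1)] partition_onD1[OF assms(2)]
      partition_onD3[OF assms(1)] partition_onD3[OF assms(2)]
    by (simp add: partition_on_def)
qed

lemma is_scd_wf_labeled_digraph: "is_scd t \<Longrightarrow> wf_labeled_digraph (node_graph t)"
proof (induction t)
  case (Leaf v)
  show ?case
    by (auto simp: wf_labeled_digraph_def partition_on_def disjoint_def
        pair_fin_digraph_def pair_fin_digraph_axioms_def pair_wf_digraph_def)
next
  case (Join t1 t2)
  then have "partition_on (pverts (unlabeled (node_graph (Join t1 t2)))) (labels (node_graph (Join t1 t2)))"
    by (simp add: wf_labeled_digraph_def partition_on_disjoint_Un)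
  with Join show ?case
    by (auto simp: wf_labeled_digraph_def pair_fin_digraph_def pair_fin_digraph_axioms_def
        pair_wf_digraph_def)
next
  case (AddVertex v t)
  then have "partition_on (insert v (pverts (unlabeled (node_graph t)))) (insert {v} (labels (node_graph t)))"
    using partition_on_disjoint_Un[OF partition_on_space[of "{v}"],
        of "pverts (unlabeled (node_graph t))" "labels (node_graph t)"]
    by (simp add: wf_labeled_digraph_def)
  with AddVertex show ?case
    by (auto simp: wf_labeled_digraph_def pair_fin_digraph_def pair_fin_digraph_axioms_def
        pair_wf_digraph_def)
next
  case (UniteLabels S1 S2 t)
  let ?P = "labels (node_graph t)"
  have P: "partition_on (pverts (unlabeled (node_graph t))) ?P" and S: "S1 \<in> ?P" "S2 \<in> ?P"
    using UniteLabels by (auto simp: wf_labeled_digraph_def)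
  have "A \<inter> (S1 \<union> S2) = {}" if "A \<in> ?P - {S1, S2}" for A
    using that S partition_onD2[OF P] unfolding disjoint_def by blast
  moreover have "disjoint (?P - {S1, S2})"
    using partition_onD2[OF P] unfolding disjoint_def by blast
  ultimately have "disjoint (insert (S1 \<union> S2) (?P - {S1, S2}))"
    unfolding disjoint_def by blast
  moreover have "\<Union> (insert (S1 \<union> S2) (?P - {S1, S2})) = pverts (unlabeled (node_graph t))"
    using S partition_onD1[OF P] by blast
  moreover have "{} \<notin> insert (S1 \<union> S2) (?P - {S1, S2})"
    using S partition_onD3[OF P] by auto
  ultimately have "partition_on (pverts (unlabeled (node_graph t))) (insert (S1 \<union> S2) (?P - {S1, S2}))"
    unfolding partition_on_def by blast
  with UniteLabels show ?case
    by (simp add: wf_labeled_digraph_def)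
next
  case (AddArcs S1 S2 t)
  then have "finite (pverts (unlabeled (node_graph t)))"
    and sub: "S1 \<subseteq> pverts (unlabeled (node_graph t))" "S2 \<subseteq> pverts (unlabeled (node_graph t))"
    by (auto simp: wf_labeled_digraph_def partition_on_def
        pair_fin_digraph_def pair_fin_digraph_axioms_def)
  then have "finite S1" "finite S2"
    by (auto intro: finite_subset)
  with AddArcs sub show ?case
    by (auto simp: wf_labeled_digraph_def pair_fin_digraph_def pair_fin_digraph_axioms_def
        pair_wf_digraph_def)
qed

text \<open>The nodes of the tree, each identified with the subtree rooted at it.\<close>

fun nodes :: "'a scd \<Rightarrow> 'a scd set" where
  "nodes (Leaf v) = {Leaf v}"
| "nodes (Join t1 t2) = insert (Join t1 t2) (nodes t1 \<union> nodes t2)"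
| "nodes (AddVertex v t1) = insert (AddVertex v t1) (nodes t1)"
| "nodes (UniteLabels S1 S2 t1) = insert (UniteLabels S1 S2 t1) (nodes t1)"
| "nodes (AddArcs S1 S2 t1) = insert (AddArcs S1 S2 t1) (nodes t1)"

definition scd_labels :: "'a scd \<Rightarrow> 'a set set" where
  "scd_labels D = (\<Union>t \<in> nodes D. labels (node_graph t))"

definition scd_width :: "'a scd \<Rightarrow> nat" where
  "scd_width D = Max ((\<lambda>t. card (labels (node_graph t))) ` nodes D)"

definition child_label :: "'a scd \<Rightarrow> 'a set \<Rightarrow> 'a set \<Rightarrow> bool" where
  "child_label D S' S \<longleftrightarrow>
     (\<exists>S1 S2 t. UniteLabels S1 S2 t \<in> nodes D \<and> S = S1 \<union> S2 \<and> S' \<in> {S1, S2})"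

definition label_arc :: "'a scd \<Rightarrow> 'a set \<Rightarrow> 'a set \<Rightarrow> bool" where
  "label_arc D S1 S2 \<longleftrightarrow> (\<exists>t. AddArcs S1 S2 t \<in> nodes D)"

definition scd_of :: "'a scd \<Rightarrow> ('a, 'v) circuit \<Rightarrow> bool" where
  "scd_of D F \<longleftrightarrow> is_scd D \<and> unlabeled (node_graph D) = dag F"

definition unary_label :: "('a, 'v) circuit \<Rightarrow> 'a set \<Rightarrow> bool" where
  "unary_label F S \<longleftrightarrow> (\<forall>g \<in> S. is_input F g \<or> kind F g = NotG)"

definition and_label :: "('a, 'v) circuit \<Rightarrow> 'a set \<Rightarrow> bool" where
  "and_label F S \<longleftrightarrow> (\<forall>g \<in> S. kind F g = AndG)"

definition or_label :: "('a, 'v) circuit \<Rightarrow> 'a set \<Rightarrow> bool" where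
  "or_label F S \<longleftrightarrow> (\<forall>g \<in> S. kind F g = OrG)"

definition type_respecting :: "('a, 'v) circuit \<Rightarrow> 'a scd \<Rightarrow> bool" where
  "type_respecting F D \<longleftrightarrow>
     (\<forall>S \<in> scd_labels D. \<not> is_singleton S \<longrightarrow>
        unary_label F S \<or> and_label F S \<or> or_label F S)"


section \<open>The circuit \<open>F*\<close>\<close>

text \<open>
  \<open>InNot1 S\<close> and \<open>InNot2 S\<close> are the two NOT gates of the chain \<open>in(S)\<close> of a unary label:
  wires into \<open>in(S)\<close> end at the first one, wires out of \<open>in(S)\<close> start at the second one.
\<close>

datatype 'a star_gate =
    Orig 'a
  | OAnd "'a set"
  | OOr "'a set"
  | In "'a set"
  | InNot1 "'a set"
  | InNot2 "'a set"

definition oand :: "'a set \<Rightarrow> 'a star_gate" where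
  "oand S = (if is_singleton S then Orig (the_elem S) else OAnd S)"

definition oor :: "'a set \<Rightarrow> 'a star_gate" where
  "oor S = (if is_singleton S then Orig (the_elem S) else OOr S)"

definition in_entry :: "('a, 'v) circuit \<Rightarrow> 'a set \<Rightarrow> 'a star_gate" where
  "in_entry F S =
     (if is_singleton S then Orig (the_elem S)
      else if unary_label F S then InNot1 S else In S)"

definition in_exit :: "('a, 'v) circuit \<Rightarrow> 'a set \<Rightarrow> 'a star_gate" where
  "in_exit F S =
     (if is_singleton S then Orig (the_elem S)
      else if unary_label F S then InNot2 S else In S)"

definition input_free :: "('a, 'v) circuit \<Rightarrow> 'a set \<Rightarrow> bool" where
  "input_free F S \<longleftrightarrow> (\<forall>g \<in> S. \<not> is_input F g)"

definition new_out_gates :: "'a scd \<Rightarrow> 'a star_gate set" where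
  "new_out_gates D = (\<Union>S \<in> {S \<in> scd_labels D. \<not> is_singleton S}. {OAnd S, OOr S})"

definition new_in_gates :: "('a, 'v) circuit \<Rightarrow> 'a scd \<Rightarrow> 'a star_gate set" where
  "new_in_gates F D =
     (\<Union>S \<in> {S \<in> scd_labels D. \<not> is_singleton S \<and> input_free F S}.
        if unary_label F S then {InNot1 S, InNot2 S} else {In S})"

definition star_kind :: "('a, 'v) circuit \<Rightarrow> 'a star_gate \<Rightarrow> 'v gate_kind" where
  "star_kind F g =
     (case g of
        Orig h \<Rightarrow> kind F h
      | OAnd S \<Rightarrow> AndG
      | OOr S \<Rightarrow> OrG
      | In S \<Rightarrow> (if and_label F S then AndG else OrG)
      | InNot1 S \<Rightarrow> NotG
      | InNot2 S \<Rightarrow> NotG)"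

text \<open>
  The wires before the removal step. The argument \<open>c\<close> is the arbitrary choice between
  \<open>oand(S1)\<close> and \<open>oor(S1)\<close> for an arc from \<open>S1\<close> to a label \<open>S2\<close> of NOT gates.
\<close>

inductive_set star_wires ::
    "('a, 'v) circuit \<Rightarrow> 'a scd \<Rightarrow> ('a set \<Rightarrow> 'a set \<Rightarrow> bool) \<Rightarrow> ('a star_gate \<times> 'a star_gate) set"
  for F D c where
  child_oand: "child_label D S1 S2 \<Longrightarrow> (oand S1, oand S2) \<in> star_wires F D c"
| child_oor: "child_label D S1 S2 \<Longrightarrow> (oor S1, oor S2) \<in> star_wires F D c"
| child_in: "child_label D S1 S2 \<Longrightarrow> input_free F S2 \<Longrightarrow>
    (in_exit F S2, in_entry F S1) \<in> star_wires F D c"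
| not_chain: "S \<in> scd_labels D \<Longrightarrow> \<not> is_singleton S \<Longrightarrow> unary_label F S \<Longrightarrow> input_free F S \<Longrightarrow>
    (InNot1 S, InNot2 S) \<in> star_wires F D c"
| arc_and: "label_arc D S1 S2 \<Longrightarrow> and_label F S2 \<Longrightarrow>
    (oand S1, in_entry F S2) \<in> star_wires F D c"
| arc_or: "label_arc D S1 S2 \<Longrightarrow> or_label F S2 \<Longrightarrow>
    (oor S1, in_entry F S2) \<in> star_wires F D c"
| arc_not: "label_arc D S1 S2 \<Longrightarrow> unary_label F S2 \<Longrightarrow> input_free F S2 \<Longrightarrow>
    (if c S1 S2 then oand S1 else oor S1, in_entry F S2) \<in> star_wires F D c"

text \<open>
  Iterative removal: a new in-gate goes once all gates with a wire into it are gone.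
  Original gates are never removed, although \<open>in({g}) = g\<close>.
\<close>

inductive_set removed_gates ::
    "('a, 'v) circuit \<Rightarrow> 'a scd \<Rightarrow> ('a set \<Rightarrow> 'a set \<Rightarrow> bool) \<Rightarrow> 'a star_gate set"
  for F D c where
  "g \<in> new_in_gates F D \<Longrightarrow>
   (\<And>h. (h, g) \<in> star_wires F D c \<Longrightarrow> h \<in> removed_gates F D c) \<Longrightarrow>
   g \<in> removed_gates F D c"

definition star_circuit ::
    "('a, 'v) circuit \<Rightarrow> 'a scd \<Rightarrow> ('a set \<Rightarrow> 'a set \<Rightarrow> bool) \<Rightarrow> ('a star_gate, 'v) circuit" where
  "star_circuit F D c =
     (let V = (Orig ` pverts (dag F) \<union> new_out_gates D \<union> new_in_gates F D) - removed_gates F D c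
      in \<lparr> dag = \<lparr> pverts = V, parcs = star_wires F D c \<inter> V \<times> V \<rparr>,
           kind = star_kind F \<rparr>)"


section \<open>Tree decompositions\<close>

text \<open>
  Undirected graphs are symmetric digraphs, so an edge gives a directed cycle of length 2
  and only longer cycles are cycles of the undirected graph. The library constant
  \<open>Digraph_Component.tree\<close> forbids directed cycles only and does not describe undirected trees.
\<close>

definition undirected_tree :: "'b pair_pre_digraph \<Rightarrow> bool" where
  "undirected_tree T \<longleftrightarrow>
     pair_graph T \<and> connected (with_proj T) \<and>
     (\<forall>p. pre_digraph.cycle (with_proj T) p \<longrightarrow> length p \<le> 2)"

text \<open>\<open>connected\<close> includes non-emptiness.\<close>

definition tree_decomposition ::
    "'a pair_pre_digraph \<Rightarrow> 'b pair_pre_digraph \<Rightarrow> ('b \<Rightarrow> 'a set) \<Rightarrow> bool" where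
  "tree_decomposition H T B \<longleftrightarrow>
     undirected_tree T \<and>
     (\<forall>t \<in> pverts T. finite (B t)) \<and>
     (\<Union>t \<in> pverts T. B t) = pverts H \<and>
     (\<forall>(u, v) \<in> parcs H. \<exists>t \<in> pverts T. u \<in> B t \<and> v \<in> B t) \<and>
     (\<forall>v \<in> pverts H. connected (with_proj T \<restriction> {t \<in> pverts T. v \<in> B t}))"

definition decomposition_width :: "'b pair_pre_digraph \<Rightarrow> ('b \<Rightarrow> 'a set) \<Rightarrow> nat" where
  "decomposition_width T B = Max ((\<lambda>t. card (B t)) ` pverts T) - 1"

end

theory Submission
  imports Defs
begin

text \<open>
  Labels only disappear at nodes that unite two of them. Cutting the decomposition below each such
  node therefore leaves regions in which every label is still present at the top of the region, so
  that one bag with the gates \<open>oand\<close>, \<open>oor\<close> and the entry gate of \<open>in\<close> of those at most \<open>k\<close> labels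
  covers all wires coming from arcs. Where labels \<open>S1\<close> and \<open>S2\<close> are united to \<open>S\<close>, the bag below
  additionally receives \<open>oand S\<close>, \<open>oor S\<close> and the exit gate of \<open>in S\<close>, and a connecting bag above it
  contains both NOT gates of the chain \<open>in S\<close>. Every unite operation lowers the number of labels
  by one, so there are at most \<open>|F| - 1\<close> of them and at most \<open>2 |F| - 1\<close> bags. Removing gates only
  shrinks bags.
\<close>

section \<open>Tree decompositions from the running intersection property\<close>

text \<open>Bags are numbered in order of creation, with root 0; \<open>par 0\<close> is never
  consulted. Each edge occurs in both directions, since undirected trees are symmetric digraphs
  here.\<close>

definition parent_tree :: "nat \<Rightarrow> (nat \<Rightarrow> nat) \<Rightarrow> nat pair_pre_digraph" where
  "parent_tree N par =
     \<lparr> pverts = {..<N}, parcs = (\<Union>i \<in> {0<..<N}. {(i, par i), (par i, i)}) \<rparr>"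

text \<open>The running intersection property of junction trees. It yields the connectivity
  condition of tree decompositions, but can be checked one bag at a time while a tree grows by
  leaves.\<close>

definition running_intersection :: "nat \<Rightarrow> (nat \<Rightarrow> nat) \<Rightarrow> (nat \<Rightarrow> 'g set) \<Rightarrow> bool" where
  "running_intersection N par B \<longleftrightarrow>
     0 < N \<and> (\<forall>i. 0 < i \<and> i < N \<longrightarrow> par i < i \<and> B i \<inter> (\<Union>j<i. B j) \<subseteq> B (par i))"

lemma parcs_parent_tree_iff:
  "(x, y) \<in> parcs (parent_tree N par) \<longleftrightarrow>
     0 < x \<and> x < N \<and> y = par x \<or> 0 < y \<and> y < N \<and> x = par y"
  by (auto simp: parent_tree_def)

section \<open>Walks and cycles in parent trees\<close>

lemma pcas_pred_arc:
  assumes "pcas u p v" "i < length p" "0 < i"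
  shows "fst (p ! i) = snd (p ! (i - 1))"
  using assms
proof (induction p arbitrary: u i)
  case (Cons e p)
  then show ?case
    by (cases i; cases p) (auto simp: nth_Cons' split: if_splits)
qed simp

lemma pcas_ends:
  assumes "pcas u p v" "p \<noteq> []"
  shows "fst (p ! 0) = u" "snd (p ! (length p - 1)) = v"
  using assms
proof (induction p arbitrary: u)
  case (Cons e p)
  {
    case 1 then show ?case by simp
  next
    case 2 then show ?case using Cons(2)[of "snd e"] by (cases "p = []") (auto simp: nth_Cons')
  }
qed simp_all

text \<open>A cycle has a distinct tail of its vertex list; this turns that condition into
  distinctness of the arc heads, which can be indexed like the arcs.\<close>

lemma tl_pawalk_verts: "pcas u p v \<Longrightarrow> tl (pawalk_verts u p) = map snd p"
proof (induction p arbitrary: u)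
  case (Cons e p)
  then have "pawalk_verts (snd e) p = snd e # tl (pawalk_verts (snd e) p)"
    by (cases p) auto
  with Cons show ?case by auto
qed simp

text \<open>
  On a cycle, both neighbours of the largest vertex are its parent, so they coincide.
\<close>

lemma parent_tree_cycle_length:
  assumes par: "\<And>i. 0 < i \<Longrightarrow> i < N \<Longrightarrow> par i < i"
    and cyc: "pre_digraph.cycle (with_proj (parent_tree N par)) p"
  shows "length p \<le> 2"
proof -
  let ?n = "length p"
  obtain u where p: "p \<noteq> []" and arcs: "set p \<subseteq> parcs (parent_tree N par)"
    and cas: "pcas u p u" and dist: "distinct (map snd p)"
    using cyc by (auto simp: pre_digraph.cycle_def pre_digraph.awalk_def cas_with_proj_eq
        awalk_verts_with_proj_eq tl_pawalk_verts)
  \<comment> \<open>The cyclic predecessor of an index: as the walk is closed, its last arc precedes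
    its first.\<close>
  define pred where "pred i = (if i = 0 then ?n - 1 else i - 1)" for i
  have pred: "fst (p ! i) = snd (p ! pred i)" "pred i < ?n" if "i < ?n" for i
    using that pcas_pred_arc[OF cas, of i] pcas_ends[OF cas p] by (auto simp: pred_def)
  define m where "m = Max (snd ` set p)"
  have "m \<in> snd ` set p" unfolding m_def using p by (intro Max_in) auto
  then obtain i where i: "i < ?n" "snd (p ! i) = m" by (metis imageE in_set_conv_nth)
  define j where "j = (if i = ?n - 1 then 0 else i + 1)"
  have j: "j < ?n" "pred j = i" using i by (auto simp: j_def pred_def)
  have le: "snd (p ! l) \<le> m" if "l < ?n" for l
    unfolding m_def using that by (intro Max_ge) auto
  \<comment> \<open>Of the two ends of an edge, the larger one is the child.\<close>
  have down: "y = par x" if "(x, y) \<in> parcs (parent_tree N par) \<or> (y, x) \<in> parcs (parent_tree N par)"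
    and "y \<le> x" for x y
    using that par[of x] par[of y] by (auto simp: parcs_parent_tree_iff)
  have mem: "p ! l \<in> parcs (parent_tree N par)" if "l < ?n" for l
    using that arcs nth_mem by blast
  have "fst (p ! i) = par m"
    using down[of m "fst (p ! i)"] mem[OF i(1)] pred[OF i(1)] le i by (cases "p ! i") auto
  moreover have "fst (p ! j) = m" using pred[OF j(1)] j i by simp
  then have "snd (p ! j) = par m"
    using down[of m "snd (p ! j)"] mem[OF j(1)] le[OF j(1)] by (cases "p ! j") auto
  ultimately have "snd (p ! j) = snd (p ! pred i)" using pred[OF i(1)] by simp
  then have "j = pred i"
    using dist j(1) pred(2)[OF i(1)] nth_eq_iff_index_eq[OF dist, of j "pred i"] by simp
  \<comment> \<open>The cyclic successor and predecessor of \<open>i\<close> agree, which leaves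
    room for at most two indices.\<close>
  then show ?thesis using i(1) by (auto simp: j_def pred_def split: if_splits)
qed

text \<open>From any element of \<open>X\<close>, following parents leads down to the least element
  \<open>r\<close>: the closure condition keeps the path inside \<open>X\<close> until
  \<open>r\<close> is reached.\<close>

lemma connected_parent_tree_restriction:
  assumes par: "\<And>i. 0 < i \<Longrightarrow> i < N \<Longrightarrow> par i < i"
    and X: "X \<subseteq> {..<N}" "X \<noteq> {}"
    and closed: "\<And>i j. i \<in> X \<Longrightarrow> j \<in> X \<Longrightarrow> j < i \<Longrightarrow> par i \<in> X"
  shows "connected (with_proj (parent_tree N par) \<restriction> X)"
proof -
  let ?M = "mk_symmetric (with_proj (parent_tree N par) \<restriction> X)"
  define r where "r = (LEAST i. i \<in> X)"
  have r: "r \<in> X" "\<And>i. i \<in> X \<Longrightarrow> r \<le> i"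
    using X(2) by (auto simp: r_def intro: LeastI Least_le)
  interpret M: pair_wf_digraph ?M
    using X by unfold_locales (auto simp: parcs_mk_symmetric parent_tree_def)
  have sym: "symmetric ?M" by (rule symmetric_mk_symmetric)
  have to_r: "i \<rightarrow>\<^sup>*\<^bsub>?M\<^esub> r" if "i \<in> X" for i
    using that
  proof (induction i rule: less_induct)
    case (less i)
    show ?case
    proof (cases "i = r")
      case True then show ?thesis using r by auto
    next
      case False
      then have "r < i" using r less.prems by (simp add: le_neq_implies_less)
      then have i: "par i \<in> X" "0 < i" "i < N" using closed[OF less.prems r(1)] X less.prems by auto
      then have "(i, par i) \<in> parcs ?M"
        using less.prems by (force simp: parcs_mk_symmetric parent_tree_def)
      moreover have "par i \<rightarrow>\<^sup>*\<^bsub>?M\<^esub> r" using less.IH par i by auto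
      ultimately show ?thesis using M.adj_reachable_trans by auto
    qed
  qed
  \<comment> \<open>The path from \<open>u\<close> to \<open>r\<close> is followed by the reversed
    path from \<open>v\<close> to \<open>r\<close>.\<close>
  have "u \<rightarrow>\<^sup>*\<^bsub>?M\<^esub> v" if "u \<in> X" "v \<in> X" for u v
    using to_r[OF that(1)] symmetric_reachable[OF sym to_r[OF that(2)]] M.reachable_trans by blast
  then show ?thesis
    unfolding connected_def using X by (intro strongly_connectedI) auto
qed

lemma undirected_tree_parent_tree:
  assumes "0 < N" and par: "\<And>i. 0 < i \<Longrightarrow> i < N \<Longrightarrow> par i < i"
  shows "undirected_tree (parent_tree N par)"
proof -
  have lt: "par i < N" if "0 < i" "i < N" for i using par[OF that] that by simp
  have arcs: "x < N \<and> y < N \<and> x \<noteq> y \<and> (y, x) \<in> parcs (parent_tree N par)"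
    if "(x, y) \<in> parcs (parent_tree N par)" for x y
    using that par[of x] par[of y] lt[of x] lt[of y] by (auto simp: parcs_parent_tree_iff)
  have verts: "pverts (parent_tree N par) = {..<N}" by (simp add: parent_tree_def)
  have "finite (parcs (parent_tree N par))" by (simp add: parent_tree_def)
  then have "pair_graph (parent_tree N par)"
    by unfold_locales (auto simp: verts symmetric_def intro!: symI dest: arcs)
  moreover have "connected (with_proj (parent_tree N par) \<restriction> {..<N})"
  proof (rule connected_parent_tree_restriction[OF par])
    show "par i \<in> {..<N}" if "i \<in> {..<N}" "j < i" for i j using lt[of i] that by auto
  qed (use assms in auto)
  moreover have "with_proj (parent_tree N par) \<restriction> {..<N} = with_proj (parent_tree N par)"
    using arcs by (auto simp: induce_subgraph_def with_proj_def verts)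
  ultimately show ?thesis
    unfolding undirected_tree_def using parent_tree_cycle_length[OF par] by auto
qed

text \<open>A vertex that lies in a bag and in an earlier one also lies in the parent bag. This is
  the closure condition for the set of bags containing the vertex.\<close>

lemma tree_decomposition_running_intersection:
  assumes ri: "running_intersection N par B"
    and fin: "\<And>i. i < N \<Longrightarrow> finite (B i)"
    and verts: "(\<Union>i<N. B i) = pverts H"
    and arcs: "\<And>u v. (u, v) \<in> parcs H \<Longrightarrow> \<exists>i<N. u \<in> B i \<and> v \<in> B i"
  shows "tree_decomposition H (parent_tree N par) B"
proof -
  have N: "0 < N" and par: "\<And>i. 0 < i \<Longrightarrow> i < N \<Longrightarrow> par i < i"
    and int: "\<And>i. 0 < i \<Longrightarrow> i < N \<Longrightarrow> B i \<inter> (\<Union>j<i. B j) \<subseteq> B (par i)"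
    using ri by (auto simp: running_intersection_def)
  have "connected (with_proj (parent_tree N par) \<restriction> {t. t < N \<and> v \<in> B t})" if "v \<in> pverts H" for v
  proof (rule connected_parent_tree_restriction[OF par])
    show "{t. t < N \<and> v \<in> B t} \<noteq> {}" using that verts by auto
    show "par i \<in> {t. t < N \<and> v \<in> B t}"
      if "i \<in> {t. t < N \<and> v \<in> B t}" "j \<in> {t. t < N \<and> v \<in> B t}" "j < i" for i j
      using that int[of i] par[of i] by fastforce
  qed auto
  moreover have "pverts (parent_tree N par) = {..<N}" by (simp add: parent_tree_def)
  ultimately show ?thesis
    unfolding tree_decomposition_def
    using undirected_tree_parent_tree[OF N par] fin verts by (auto dest: arcs)
qed

text \<open>Serves to cut bags down to the gates that are really present in
  \<open>F*\<close>.\<close>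

lemma running_intersection_restrict:
  "running_intersection N par B \<Longrightarrow> running_intersection N par (\<lambda>i. B i \<inter> V)"
  unfolding running_intersection_def by fast

text \<open>The new leaf takes the next free number, so the conditions on the older bags are
  untouched and only the new bag has to be compared with its parent \<open>r\<close>.\<close>

lemma running_intersection_Suc:
  assumes "running_intersection N par B" "r < N" "X \<inter> (\<Union>i<N. B i) \<subseteq> B r"
  shows "running_intersection (Suc N) (par(N := r)) (B(N := X))"
  unfolding running_intersection_def
proof (intro conjI allI impI)
  fix i assume i: "0 < i \<and> i < Suc N"
  have U: "(\<Union>j<i. (B(N := X)) j) = (\<Union>j<i. B j)" using i by auto
  show "(par(N := r)) i < i" using assms i by (auto simp: running_intersection_def less_Suc_eq)
  show "(B(N := X)) i \<inter> (\<Union>j<i. (B(N := X)) j) \<subseteq> (B(N := X)) ((par(N := r)) i)"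
  proof (cases "i = N")
    case True then show ?thesis using assms U by auto
  next
    case False
    then have "i < N" "par i < i" "B i \<inter> (\<Union>j<i. B j) \<subseteq> B (par i)"
      using i assms(1) by (auto simp: running_intersection_def)
    then show ?thesis using U by auto
  qed
qed simp


section \<open>The gates of a label\<close>

text \<open>The exit gate is left out, which keeps the count at three. It differs from the entry
  gate only for non-singleton unary labels, and its wires then only come from the first NOT gate or
  go to children of the label. Gates are listed even if \<open>F*\<close> lacks them; the surplus is
  cut away at the end.\<close>

definition front_gates :: "('a, 'v) circuit \<Rightarrow> 'a set \<Rightarrow> 'a star_gate set" where
  "front_gates F S = {oand S, oor S, in_entry F S}"

definition label_gates :: "('a, 'v) circuit \<Rightarrow> 'a set \<Rightarrow> 'a star_gate set" where
  "label_gates F S = {oand S, oor S, in_entry F S, in_exit F S}"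

definition node_front :: "('a, 'v) circuit \<Rightarrow> 'a scd \<Rightarrow> 'a star_gate set" where
  "node_front F t = (\<Union>S \<in> labels (node_graph t). front_gates F S)"

definition scd_gates :: "('a, 'v) circuit \<Rightarrow> 'a scd \<Rightarrow> 'a star_gate set" where
  "scd_gates F t = (\<Union>S \<in> scd_labels t. label_gates F S)"

text \<open>Recovers the label from a gate, so that disjointness of sets of gates reduces to
  statements about labels as vertex sets.\<close>

fun gate_support :: "'a star_gate \<Rightarrow> 'a set" where
  "gate_support (Orig v) = {v}"
| "gate_support (OAnd S) = S"
| "gate_support (OOr S) = S"
| "gate_support (In S) = S"
| "gate_support (InNot1 S) = S"
| "gate_support (InNot2 S) = S"

lemma gate_support_label_gates: "g \<in> label_gates F S \<Longrightarrow> gate_support g = S"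
  by (auto simp: label_gates_def oand_def oor_def in_entry_def in_exit_def is_singleton_the_elem
      split: if_splits)

lemma gate_support_scd_gates: "g \<in> scd_gates F t \<Longrightarrow> gate_support g \<in> scd_labels t"
  by (auto simp: scd_gates_def dest: gate_support_label_gates)

lemma front_gates_subset: "front_gates F S \<subseteq> label_gates F S"
  by (auto simp: front_gates_def label_gates_def)

lemma self_in_nodes: "t \<in> nodes t"
  by (cases t) auto

lemma node_front_subset: "node_front F t \<subseteq> scd_gates F t"
  using front_gates_subset self_in_nodes by (force simp: node_front_def scd_gates_def scd_labels_def)

lemma finite_nodes: "finite (nodes t)"
  by (induction t) auto

lemma labels_subset_scd_labels: "labels (node_graph t) \<subseteq> scd_labels t"
  using self_in_nodes by (auto simp: scd_labels_def)

lemma scd_labels_simps: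
  "scd_labels (Leaf v) = {{v}}"
  "scd_labels (Join t1 t2) = scd_labels t1 \<union> scd_labels t2"
  "scd_labels (AddVertex v t) = insert {v} (scd_labels t)"
  "scd_labels (UniteLabels S1 S2 t) = insert (S1 \<union> S2) (scd_labels t)"
  "scd_labels (AddArcs S1 S2 t) = scd_labels t"
  using labels_subset_scd_labels[of t] labels_subset_scd_labels[of t1] labels_subset_scd_labels[of t2]
  by (auto simp: scd_labels_def)

lemma finite_scd_labels: "finite (scd_labels t)"
  by (induction t) (auto simp: scd_labels_simps)

lemma finite_scd_gates: "finite (scd_gates F t)"
  by (auto simp: scd_gates_def finite_scd_labels label_gates_def)

lemma finite_labels: "finite (labels (node_graph t))"
  using labels_subset_scd_labels finite_scd_labels by (rule finite_subset)

section \<open>Labels as vertex sets\<close>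

lemma partition_labels:
  "is_scd t \<Longrightarrow> partition_on (pverts (unlabeled (node_graph t))) (labels (node_graph t))"
  using is_scd_wf_labeled_digraph by (auto simp: wf_labeled_digraph_def)

lemma finite_pverts: "finite (pverts (unlabeled (node_graph t)))"
  by (induction t) auto

text \<open>Labels are never split: one that disappears is replaced by a union containing
  it.\<close>

lemma scd_label_below_label:
  assumes "is_scd t" "S \<in> scd_labels t"
  shows "S \<noteq> {} \<and> (\<exists>S' \<in> labels (node_graph t). S \<subseteq> S')"
  using assms
proof (induction t)
  case (UniteLabels S1 S2 t)
  have "S1 \<noteq> {}" using UniteLabels.prems partition_onD3[OF partition_labels[of t]] by auto
  consider "S = S1 \<union> S2" | "S \<in> scd_labels t"
    using UniteLabels.prems by (auto simp: scd_labels_simps)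
  then show ?case
  proof cases
    case 1 then show ?thesis using \<open>S1 \<noteq> {}\<close> by auto
  next
    case 2
    then obtain S' where "S \<noteq> {}" "S' \<in> labels (node_graph t)" "S \<subseteq> S'"
      using UniteLabels by auto
    then show ?thesis by (cases "S' \<in> {S1, S2}") auto
  qed
qed (auto simp: scd_labels_simps)

lemma scd_label_subset_pverts:
  assumes "is_scd t" "S \<in> scd_labels t"
  shows "S \<noteq> {}" "S \<subseteq> pverts (unlabeled (node_graph t))"
  using scd_label_below_label[OF assms] partition_onD1[OF partition_labels[OF assms(1)]] by auto

lemma singleton_in_scd_labels:
  "v \<in> pverts (unlabeled (node_graph t)) \<Longrightarrow> {v} \<in> scd_labels t"
  by (induction t) (auto simp: scd_labels_simps)

text \<open>Every label of \<open>t\<close> lies inside one block of the current partition, whereas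
  the union meets two different blocks. Hence the gates of the united label cannot occur among those
  of \<open>t\<close>.\<close>

lemma united_label_new:
  assumes "is_scd (UniteLabels S1 S2 t)"
  shows "S1 \<union> S2 \<notin> scd_labels t" "\<not> is_singleton (S1 \<union> S2)"
proof -
  let ?L = "labels (node_graph t)"
  have S: "S1 \<in> ?L" "S2 \<in> ?L" "S1 \<noteq> S2" and t: "is_scd t" using assms by auto
  note P = partition_labels[OF t]
  have ne: "S1 \<noteq> {}" "S2 \<noteq> {}" using S partition_onD3[OF P] by auto
  have disj: "S1 \<inter> S2 = {}" using S partition_onD2[OF P] by (auto simp: disjoint_def)
  show "\<not> is_singleton (S1 \<union> S2)" using ne disj by (metis is_singleton_def Un_singleton_iff inf.idem insert_not_empty)
  show "S1 \<union> S2 \<notin> scd_labels t"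
  proof
    assume "S1 \<union> S2 \<in> scd_labels t"
    then obtain S' where "S' \<in> ?L" "S1 \<union> S2 \<subseteq> S'" using scd_label_below_label[OF t] by blast
    then have "S' = S1" "S' = S2" using S ne partition_onD2[OF P] unfolding disjoint_def by blast+
    then show False using S by simp
  qed
qed

section \<open>Counting unite nodes and front gates\<close>

fun unite_count :: "'a scd \<Rightarrow> nat" where
  "unite_count (Leaf v) = 0"
| "unite_count (Join t1 t2) = unite_count t1 + unite_count t2"
| "unite_count (AddVertex v t) = unite_count t"
| "unite_count (UniteLabels S1 S2 t) = Suc (unite_count t)"
| "unite_count (AddArcs S1 S2 t) = unite_count t"

text \<open>The left-hand side is a potential: a new vertex raises it by at most one, and a unite
  node adds one to the count while trading two labels for one.\<close>

lemma unite_count_bound: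
  "is_scd t \<Longrightarrow> unite_count t + card (labels (node_graph t)) \<le> card (pverts (unlabeled (node_graph t)))"
proof (induction t)
  case (Join t1 t2)
  have "card (labels (node_graph t1) \<union> labels (node_graph t2))
      \<le> card (labels (node_graph t1)) + card (labels (node_graph t2))"
    by (rule card_Un_le)
  then show ?case using Join by (simp add: card_Un_disjoint finite_pverts)
next
  case (AddVertex v t)
  then show ?case
    using card_insert_le_m1[of "Suc (card (labels (node_graph t)))" "labels (node_graph t)" "{v}"]
    by (simp add: finite_pverts)
next
  case (UniteLabels S1 S2 t)
  let ?L = "labels (node_graph t)"
  \<comment> \<open>Ensures that the subtraction on natural numbers below is not truncated.\<close>
  have "card {S1, S2} \<le> card ?L" using UniteLabels.prems by (intro card_mono finite_labels) auto
  moreover have "card (?L - {S1, S2}) = card ?L - card {S1, S2}"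
    using UniteLabels.prems by (intro card_Diff_subset) auto
  moreover have "card (insert (S1 \<union> S2) (?L - {S1, S2})) \<le> Suc (card (?L - {S1, S2}))"
    by (simp add: card_insert_le_m1)
  ultimately show ?case using UniteLabels by auto
qed auto

lemma card_node_front: "card (node_front F t) \<le> 3 * card (labels (node_graph t))"
proof -
  have "card (node_front F t) \<le> (\<Sum>S \<in> labels (node_graph t). card (front_gates F S))"
    unfolding node_front_def by (rule card_UN_le[OF finite_labels])
  also have "\<dots> \<le> (\<Sum>S \<in> labels (node_graph t). 3)"
    unfolding front_gates_def by (intro sum_mono) (simp add: card_insert_if)
  finally show ?thesis by simp
qed

lemma labels_nonempty: "labels (node_graph t) \<noteq> {}"
  by (induction t) auto

section \<open>Gates along the constructors of the decomposition\<close>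

lemma node_front_simps:
  "node_front F (Leaf v) = front_gates F {v}"
  "node_front F (Join t1 t2) = node_front F t1 \<union> node_front F t2"
  "node_front F (AddVertex v t) = front_gates F {v} \<union> node_front F t"
  "node_front F (AddArcs S1 S2 t) = node_front F t"
  by (auto simp: node_front_def)

lemma node_front_Unite:
  "node_front F (UniteLabels S1 S2 t) \<subseteq> front_gates F (S1 \<union> S2) \<union> node_front F t"
  "front_gates F (S1 \<union> S2) \<subseteq> node_front F (UniteLabels S1 S2 t)"
  by (auto simp: node_front_def)

lemma label_gates_singleton: "label_gates F {v} = front_gates F {v}"
  by (auto simp: label_gates_def front_gates_def in_entry_def in_exit_def)

lemma scd_gates_simps:
  "scd_gates F (Leaf v) = front_gates F {v}"
  "scd_gates F (Join t1 t2) = scd_gates F t1 \<union> scd_gates F t2"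
  "scd_gates F (AddVertex v t) = front_gates F {v} \<union> scd_gates F t"
  "scd_gates F (UniteLabels S1 S2 t) = label_gates F (S1 \<union> S2) \<union> scd_gates F t"
  "scd_gates F (AddArcs S1 S2 t) = scd_gates F t"
  by (auto simp: scd_gates_def scd_labels_simps label_gates_singleton)

text \<open>A common gate would have a nonempty support inside both vertex sets.\<close>

lemma scd_gates_disjoint:
  assumes "is_scd t1" "is_scd t2"
    and "pverts (unlabeled (node_graph t1)) \<inter> pverts (unlabeled (node_graph t2)) = {}"
  shows "scd_gates F t1 \<inter> scd_gates F t2 = {}"
proof -
  have False if "g \<in> scd_gates F t1" "g \<in> scd_gates F t2" for g
    using scd_label_subset_pverts[OF assms(1) gate_support_scd_gates[OF that(1)]]
      scd_label_subset_pverts[OF assms(2) gate_support_scd_gates[OF that(2)]] assms(3) by blast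
  then show ?thesis by blast
qed

lemma label_gates_disjoint_scd_gates:
  assumes "S \<notin> scd_labels t"
  shows "label_gates F S \<inter> scd_gates F t = {}"
proof -
  have False if "g \<in> label_gates F S" "g \<in> scd_gates F t" for g
    using gate_support_label_gates[OF that(1)] gate_support_scd_gates[OF that(2)] assms by simp
  then show ?thesis by blast
qed


section \<open>The wires of a decomposition\<close>

lemma child_label_simps:
  "child_label (Leaf v) S' S \<longleftrightarrow> False"
  "child_label (Join t1 t2) S' S \<longleftrightarrow> child_label t1 S' S \<or> child_label t2 S' S"
  "child_label (AddVertex v t) S' S \<longleftrightarrow> child_label t S' S"
  "child_label (UniteLabels S1 S2 t) S' S \<longleftrightarrow>
     child_label t S' S \<or> S = S1 \<union> S2 \<and> S' \<in> {S1, S2}"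
  "child_label (AddArcs S1 S2 t) S' S \<longleftrightarrow> child_label t S' S"
  subgoal by (simp add: child_label_def)
  subgoal by (simp add: child_label_def) blast
  subgoal by (simp add: child_label_def)
  subgoal by (simp add: child_label_def) blast
  subgoal by (simp add: child_label_def)
  done

lemma label_arc_simps:
  "label_arc (Leaf v) A B \<longleftrightarrow> False"
  "label_arc (Join t1 t2) A B \<longleftrightarrow> label_arc t1 A B \<or> label_arc t2 A B"
  "label_arc (AddVertex v t) A B \<longleftrightarrow> label_arc t A B"
  "label_arc (UniteLabels S1 S2 t) A B \<longleftrightarrow> label_arc t A B"
  "label_arc (AddArcs S1 S2 t) A B \<longleftrightarrow> label_arc t A B \<or> A = S1 \<and> B = S2"
  by (auto simp: label_arc_def)

lemmas scd_simps = scd_labels_simps child_label_simps label_arc_simps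

text \<open>The rule \<open>arc_not\<close> is split by the value of \<open>c\<close>, so that no
  conditional stands in the conclusion of an introduction rule.\<close>

lemma arc_not_oand:
  "label_arc D S1 S2 \<Longrightarrow> unary_label F S2 \<Longrightarrow> input_free F S2 \<Longrightarrow> c S1 S2 \<Longrightarrow>
    (oand S1, in_entry F S2) \<in> star_wires F D c"
  using star_wires.arc_not[of D S1 S2 F c] by simp

lemma arc_not_oor:
  "label_arc D S1 S2 \<Longrightarrow> unary_label F S2 \<Longrightarrow> input_free F S2 \<Longrightarrow> \<not> c S1 S2 \<Longrightarrow>
    (oor S1, in_entry F S2) \<in> star_wires F D c"
  using star_wires.arc_not[of D S1 S2 F c] by simp

lemmas star_wires_intros = star_wires.intros(1-6) arc_not_oand arc_not_oor

lemma star_wires_Leaf: "star_wires F (Leaf v) c = {}"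
  by (auto elim!: star_wires.cases simp: scd_simps)

lemma star_wires_Join:
  "star_wires F (Join t1 t2) c \<subseteq> star_wires F t1 c \<union> star_wires F t2 c"
  by (rule subrelI, erule star_wires.cases) (auto simp: scd_simps intro: star_wires_intros)

lemma star_wires_AddVertex: "star_wires F (AddVertex v t) c \<subseteq> star_wires F t c"
  by (rule subrelI, erule star_wires.cases) (auto simp: scd_simps intro: star_wires_intros)

text \<open>A wire for an arc starts at an out-gate of the first label and ends at the entry gate of
  the second, so both ends belong to front gates.\<close>

lemma star_wires_AddArcs:
  "star_wires F (AddArcs S1 S2 t) c
     \<subseteq> star_wires F t c \<union> front_gates F S1 \<times> front_gates F S2" (is "_ \<subseteq> ?R")
proof (rule subrelI)
  have arc: "label_arc t A B \<or> (\<forall>g \<in> front_gates F A. \<forall>h \<in> front_gates F B. (g, h) \<in> ?R)"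
    if "label_arc (AddArcs S1 S2 t) A B" for A B
    using that unfolding label_arc_simps by blast
  have gates: "oand A \<in> front_gates F A" "oor A \<in> front_gates F A" "in_entry F A \<in> front_gates F A" for A
    by (auto simp: front_gates_def)
  fix g h assume "(g, h) \<in> star_wires F (AddArcs S1 S2 t) c"
  then show "(g, h) \<in> ?R"
  proof cases
    case (arc_and A B)
    then show ?thesis using arc[of A B] gates star_wires_intros(5) by blast
  next
    case (arc_or A B)
    then show ?thesis using arc[of A B] gates star_wires_intros(6) by blast
  next
    case (arc_not A B)
    then show ?thesis
      using arc[of A B] gates star_wires_intros(7,8) by (cases "c A B") (simp, blast)+
  qed (simp_all add: scd_simps star_wires_intros)
qed

text \<open>The three additional sets hold, in this order, the wires from the out-gates of the
  children, those into the in-gates of the children, and the chain of NOT gates of a unary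
  \<open>S\<close>.\<close>

lemma star_wires_Unite:
  assumes S: "S = S1 \<union> S2" "\<not> is_singleton S"
  shows "star_wires F (UniteLabels S1 S2 t) c
     \<subseteq> star_wires F t c
       \<union> (front_gates F S1 \<union> front_gates F S2) \<times> {oand S, oor S}
       \<union> {in_exit F S} \<times> (front_gates F S1 \<union> front_gates F S2)
       \<union> {(in_entry F S, in_exit F S)}" (is "_ \<subseteq> ?R")
proof (rule subrelI)
  have child: "child_label t A B \<or> B = S \<and> front_gates F A \<subseteq> front_gates F S1 \<union> front_gates F S2"
    if "child_label (UniteLabels S1 S2 t) A B" for A B
    using that S unfolding child_label_simps by blast
  have gates: "oand A \<in> front_gates F A" "oor A \<in> front_gates F A" "in_entry F A \<in> front_gates F A" for A
    by (auto simp: front_gates_def)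
  fix g h assume "(g, h) \<in> star_wires F (UniteLabels S1 S2 t) c"
  then show "(g, h) \<in> ?R"
  proof cases
    case (child_oand A B)
    then show ?thesis using child[of A B] gates star_wires_intros(1) by blast
  next
    case (child_oor A B)
    then show ?thesis using child[of A B] gates star_wires_intros(2) by blast
  next
    case (child_in A B)
    then show ?thesis using child[of B A] child[of A B] gates star_wires_intros(3) by blast
  next
    case (not_chain A)
    then have "A = S \<or> A \<in> scd_labels t" using S by (simp add: scd_labels_simps)
    moreover have "g = in_entry F A" "h = in_exit F A"
      using not_chain by (simp_all add: in_entry_def in_exit_def)
    ultimately have "(g, h) = (in_entry F S, in_exit F S) \<or> (g, h) \<in> star_wires F t c"
      using not_chain star_wires_intros(4)[of A t F c] by fastforce
    then show ?thesis by blast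
  next
    case (arc_not A B)
    then show ?thesis
      using star_wires_intros(7)[of t A B F c] star_wires_intros(8)[of t A B F c]
      by (cases "c A B") (simp_all add: label_arc_simps)
  qed (simp_all add: scd_simps star_wires_intros)
qed


section \<open>The tree decomposition\<close>

text \<open>
  The decomposition is grown from the root of \<open>D\<close> downwards: the bags for the subtree \<open>t\<close> are hung
  below an existing bag \<open>B r\<close>. This way a \<open>Join\<close> needs no merging of two trees.
\<close>

lemma scd_decomposition_extension:
  assumes "is_scd t"
    and "\<forall>t' \<in> nodes t. card (labels (node_graph t')) \<le> k"
    and "running_intersection N par B" "r < N" "node_front F t \<subseteq> B r"
    and "scd_gates F t \<inter> (\<Union>i<N. B i) \<subseteq> node_front F t"
  shows "\<exists>par' B'. running_intersection (N + 2 * unite_count t) par' B' \<and>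
    (\<forall>i<N. B' i = B i) \<and>
    (\<forall>i \<in> {N..<N + 2 * unite_count t}. B' i \<subseteq> scd_gates F t \<and> card (B' i) \<le> 3 * k + 3) \<and>
    scd_gates F t \<subseteq> (\<Union>i<N + 2 * unite_count t. B' i) \<and>
    (\<forall>g h. (g, h) \<in> star_wires F t c \<longrightarrow> (\<exists>i<N + 2 * unite_count t. g \<in> B' i \<and> h \<in> B' i))"
  using assms
\<comment> \<open>The invariant: older bags meet the gates of \<open>t\<close> only in its front,
  and \<open>B r\<close> contains that whole front, so bags with gates of \<open>t\<close> can be
  hung below \<open>r\<close>. Older bags stay unchanged, and each unite node costs two new
  ones.\<close>
proof (induction t arbitrary: N par B r)
  case (Leaf v)
  then show ?case
    by (intro exI[of _ par] exI[of _ B])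
      (auto simp: scd_gates_simps node_front_simps star_wires_Leaf)
next
  case (Join t1 t2)
  let ?U = "\<Union>i<N. B i"
  define N1 where "N1 = N + 2 * unite_count t1"
  define N2 where "N2 = N1 + 2 * unite_count t2"
  have scd: "is_scd t1" "is_scd t2"
    and nodes: "\<forall>t' \<in> nodes t1. card (labels (node_graph t')) \<le> k"
      "\<forall>t' \<in> nodes t2. card (labels (node_graph t')) \<le> k"
    using Join.prems by auto
  have disj: "scd_gates F t1 \<inter> scd_gates F t2 = {}"
    using Join.prems by (intro scd_gates_disjoint) auto
  have front: "node_front F t1 \<subseteq> B r" "node_front F t2 \<subseteq> B r"
    using Join.prems by (auto simp: node_front_simps)
  have int: "scd_gates F t1 \<inter> ?U \<subseteq> node_front F t1" "scd_gates F t2 \<inter> ?U \<subseteq> node_front F t2"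
    using Join.prems(6) disj node_front_subset[of F t1] node_front_subset[of F t2]
    unfolding scd_gates_simps node_front_simps by blast+
  obtain par1 B1 where 1: "running_intersection N1 par1 B1" "\<forall>i<N. B1 i = B i"
    "\<forall>i \<in> {N..<N1}. B1 i \<subseteq> scd_gates F t1 \<and> card (B1 i) \<le> 3 * k + 3"
    "scd_gates F t1 \<subseteq> (\<Union>i<N1. B1 i)"
    "\<forall>g h. (g, h) \<in> star_wires F t1 c \<longrightarrow> (\<exists>i<N1. g \<in> B1 i \<and> h \<in> B1 i)"
    using Join.IH(1)[OF scd(1) nodes(1) Join.prems(3,4) front(1) int(1)] unfolding N1_def by blast
  \<comment> \<open>The bags for \<open>t2\<close> are hung below the same \<open>r\<close>. The
    bags added for \<open>t1\<close> contain only gates of \<open>t1\<close>, none of which belongs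
    to \<open>t2\<close>, so the invariant persists for \<open>t2\<close>.\<close>
  have "(\<Union>i<N1. B1 i) \<subseteq> ?U \<union> scd_gates F t1"
  proof
    fix g assume "g \<in> (\<Union>i<N1. B1 i)"
    then obtain i where "i < N1" "g \<in> B1 i" by auto
    then show "g \<in> ?U \<union> scd_gates F t1"
      using 1(2,3) by (cases "i < N") auto
  qed
  then have int2: "scd_gates F t2 \<inter> (\<Union>i<N1. B1 i) \<subseteq> node_front F t2"
    using int(2) disj by blast
  have r: "r < N1" "node_front F t2 \<subseteq> B1 r" using Join.prems(4) 1(2) front(2) by (auto simp: N1_def)
  obtain par2 B2 where 2: "running_intersection N2 par2 B2" "\<forall>i<N1. B2 i = B1 i"
    "\<forall>i \<in> {N1..<N2}. B2 i \<subseteq> scd_gates F t2 \<and> card (B2 i) \<le> 3 * k + 3"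
    "scd_gates F t2 \<subseteq> (\<Union>i<N2. B2 i)"
    "\<forall>g h. (g, h) \<in> star_wires F t2 c \<longrightarrow> (\<exists>i<N2. g \<in> B2 i \<and> h \<in> B2 i)"
    using Join.IH(2)[OF scd(2) nodes(2) 1(1) r int2] unfolding N2_def by blast
  have N: "N + 2 * unite_count (Join t1 t2) = N2" by (simp add: N1_def N2_def)
  have le: "N \<le> N1" "N1 \<le> N2" by (auto simp: N1_def N2_def)
  show ?case
    unfolding N scd_gates_simps
  proof (intro exI conjI)
    show "running_intersection N2 par2 B2" by (fact 2(1))
    show "\<forall>i<N. B2 i = B i" using 1(2) 2(2) le by auto
    show "\<forall>i \<in> {N..<N2}. B2 i \<subseteq> scd_gates F t1 \<union> scd_gates F t2 \<and> card (B2 i) \<le> 3 * k + 3"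
    proof
      fix i assume "i \<in> {N..<N2}"
      then show "B2 i \<subseteq> scd_gates F t1 \<union> scd_gates F t2 \<and> card (B2 i) \<le> 3 * k + 3"
        using 1(3) 2(2,3) by (cases "i < N1") (auto simp: le_sup_iff)
    qed
    have "(\<Union>i<N1. B1 i) \<subseteq> (\<Union>i<N2. B2 i)" using 2(2) le by force
    then show "scd_gates F t1 \<union> scd_gates F t2 \<subseteq> (\<Union>i<N2. B2 i)"
      by (intro Un_least order_trans[OF 1(4)] 2(4))
    have "\<exists>i<N2. g \<in> B2 i \<and> h \<in> B2 i" if gh: "(g, h) \<in> star_wires F t1 c" for g h
    proof -
      obtain i where "i < N1" "g \<in> B1 i" "h \<in> B1 i" using 1(5) gh by blast
      then show ?thesis using 2(2) le by (intro exI[of _ i]) auto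
    qed
    then show "\<forall>g h. (g, h) \<in> star_wires F (Join t1 t2) c \<longrightarrow> (\<exists>i<N2. g \<in> B2 i \<and> h \<in> B2 i)"
      using 2(5) by (fast dest!: subsetD[OF star_wires_Join])
  qed
next
  case (AddVertex v t)
  have "front_gates F {v} \<inter> scd_gates F t = {}"
    using AddVertex.prems(1) scd_label_subset_pverts(2)[of t "{v}"]
    unfolding label_gates_singleton[symmetric]
    by (intro label_gates_disjoint_scd_gates) auto
  then have int: "scd_gates F t \<inter> (\<Union>i<N. B i) \<subseteq> node_front F t"
    using AddVertex.prems(6) unfolding scd_gates_simps node_front_simps by blast
  have "is_scd t" "\<forall>t' \<in> nodes t. card (labels (node_graph t')) \<le> k" "node_front F t \<subseteq> B r"
    using AddVertex.prems by (auto simp: node_front_simps)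
  from AddVertex.IH[OF this(1,2) AddVertex.prems(3,4) this(3) int]
  obtain par' B' where *: "running_intersection (N + 2 * unite_count t) par' B'"
    "\<forall>i<N. B' i = B i"
    "\<forall>i \<in> {N..<N + 2 * unite_count t}. B' i \<subseteq> scd_gates F t \<and> card (B' i) \<le> 3 * k + 3"
    "scd_gates F t \<subseteq> (\<Union>i<N + 2 * unite_count t. B' i)"
    "\<forall>g h. (g, h) \<in> star_wires F t c \<longrightarrow> (\<exists>i<N + 2 * unite_count t. g \<in> B' i \<and> h \<in> B' i)"
    by blast
  have "front_gates F {v} \<subseteq> B' r"
    using *(2) AddVertex.prems(4,5) by (simp add: node_front_simps)
  then have "front_gates F {v} \<subseteq> (\<Union>i<N + 2 * unite_count t. B' i)"
    using AddVertex.prems(4) by fastforce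
  then have cover: "scd_gates F (AddVertex v t) \<subseteq> (\<Union>i<N + 2 * unite_count t. B' i)"
    unfolding scd_gates_simps by (intro Un_least *(4))
  show ?case
    unfolding unite_count.simps
  proof (intro exI conjI)
    show "\<forall>i \<in> {N..<N + 2 * unite_count t}.
        B' i \<subseteq> scd_gates F (AddVertex v t) \<and> card (B' i) \<le> 3 * k + 3"
      using *(3) by (auto simp: scd_gates_simps)
    show "\<forall>g h. (g, h) \<in> star_wires F (AddVertex v t) c \<longrightarrow>
        (\<exists>i<N + 2 * unite_count t. g \<in> B' i \<and> h \<in> B' i)"
      using *(5) subsetD[OF star_wires_AddVertex[of F v t c]] by auto
  qed (fact * cover)+
next
  case (UniteLabels S1 S2 t)
  define S where "S = S1 \<union> S2"
  let ?U = "\<Union>i<N. B i"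
  let ?u = "node_front F (UniteLabels S1 S2 t)"
  \<comment> \<open>\<open>X\<close> is the connecting bag, hung below \<open>r\<close>, and
    \<open>Y\<close> is hung below \<open>X\<close>. \<open>X\<close> has at most
    \<open>3 * k + 1\<close> gates and covers the chain of \<open>S\<close>; \<open>Y\<close> has at
    most \<open>3 * k + 3\<close> and covers the wires between \<open>S\<close> and its children.
    One bag for both purposes would also need the entry gate of \<open>S\<close> in
    \<open>Y\<close>, raising the bound to \<open>3 * k + 4\<close>.\<close>
  define X where "X = insert (in_exit F S) ?u"
  define Y where "Y = node_front F t \<union> {oand S, oor S, in_exit F S}"
  define B0 where "B0 = B(N := X, Suc N := Y)"
  define N' where "N' = Suc (Suc N) + 2 * unite_count t"
  note S_new = united_label_new[OF UniteLabels.prems(1), folded S_def]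
  have t: "is_scd t" "S1 \<in> labels (node_graph t)" "S2 \<in> labels (node_graph t)"
    and nodes: "\<forall>t' \<in> nodes t. card (labels (node_graph t')) \<le> k"
    and k: "card (labels (node_graph (UniteLabels S1 S2 t))) \<le> k" "card (labels (node_graph t)) \<le> k"
    using UniteLabels.prems(1,2) self_in_nodes by auto
  note front = node_front_Unite[of F S1 S2 t, folded S_def]
  have gates: "scd_gates F (UniteLabels S1 S2 t) = label_gates F S \<union> scd_gates F t"
    by (simp add: scd_gates_simps S_def)
  have disj: "label_gates F S \<inter> scd_gates F t = {}"
    by (rule label_gates_disjoint_scd_gates[OF S_new(1)])
  have XY: "X \<subseteq> label_gates F S \<union> scd_gates F t" "Y \<subseteq> label_gates F S \<union> scd_gates F t"
    using front(1) front_gates_subset[of F S] node_front_subset[of F t]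
    by (auto simp: X_def Y_def label_gates_def)
  have int: "(label_gates F S \<union> scd_gates F t) \<inter> ?U \<subseteq> ?u"
    using UniteLabels.prems(6) unfolding gates .
  have "running_intersection (Suc N) (par(N := r)) (B(N := X))"
    using UniteLabels.prems(5) int XY(1)
    by (intro running_intersection_Suc[OF UniteLabels.prems(3,4)]) blast
  moreover have "(\<Union>i<Suc N. (B(N := X)) i) = ?U \<union> X" by (auto simp: less_Suc_eq)
  \<comment> \<open>A gate of \<open>Y\<close> in an older bag belongs to the front of the unite
    node, which is part of \<open>X\<close>.\<close>
  then have "Y \<inter> (\<Union>i<Suc N. (B(N := X)) i) \<subseteq> X" using int XY(2) by (auto simp: X_def)
  ultimately have ri: "running_intersection (Suc (Suc N)) (par(N := r, Suc N := N)) B0"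
    unfolding B0_def by (intro running_intersection_Suc[of "Suc N"]) simp_all
  have "(\<Union>i<Suc (Suc N). B0 i) \<subseteq> ?U \<union> X \<union> Y"
    by (auto simp: B0_def less_Suc_eq split: if_splits)
  \<comment> \<open>The gates of \<open>S\<close> are new, so \<open>X\<close> and \<open>Y\<close>
    share only front gates with \<open>t\<close>.\<close>
  moreover have "scd_gates F t \<inter> (X \<union> Y) \<subseteq> node_front F t"
    using disj front(1) front_gates_subset[of F S] by (auto simp: X_def Y_def label_gates_def)
  moreover have "scd_gates F t \<inter> ?U \<subseteq> X" using int by (auto simp: X_def)
  ultimately have int': "scd_gates F t \<inter> (\<Union>i<Suc (Suc N). B0 i) \<subseteq> node_front F t" by blast
  have "node_front F t \<subseteq> B0 (Suc N)" by (auto simp: B0_def Y_def)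
  from UniteLabels.IH[OF t(1) nodes ri _ this int', folded N'_def]
  obtain par' B' where *: "running_intersection N' par' B'" "\<forall>i<Suc (Suc N). B' i = B0 i"
    "\<forall>i \<in> {Suc (Suc N)..<N'}. B' i \<subseteq> scd_gates F t \<and> card (B' i) \<le> 3 * k + 3"
    "scd_gates F t \<subseteq> (\<Union>i<N'. B' i)"
    "\<forall>g h. (g, h) \<in> star_wires F t c \<longrightarrow> (\<exists>i<N'. g \<in> B' i \<and> h \<in> B' i)"
    by blast
  have N: "N + 2 * unite_count (UniteLabels S1 S2 t) = N'" by (simp add: N'_def)
  have B': "B' N = X" "B' (Suc N) = Y" "N < N'" "Suc N < N'"
    using *(2) by (auto simp: B0_def N'_def)
  have cards: "card X \<le> 3 * k + 3" "card Y \<le> 3 * k + 3"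
  proof -
    have "card X \<le> Suc (card ?u)" unfolding X_def by (simp add: card_insert_le_m1)
    then show "card X \<le> 3 * k + 3" using card_node_front[of F "UniteLabels S1 S2 t"] k(1) by linarith
    have "card Y \<le> card (node_front F t) + card {oand S, oor S, in_exit F S}"
      unfolding Y_def by (rule card_Un_le)
    moreover have "card {oand S, oor S, in_exit F S} \<le> 3" by (simp add: card_insert_if)
    ultimately show "card Y \<le> 3 * k + 3" using card_node_front[of F t] k(2) by linarith
  qed
  show ?case
    unfolding N gates
  proof (intro exI conjI)
    show "running_intersection N' par' B'" by (fact *(1))
    show "\<forall>i<N. B' i = B i" using *(2) by (auto simp: B0_def)
    show "\<forall>i \<in> {N..<N'}. B' i \<subseteq> label_gates F S \<union> scd_gates F t \<and> card (B' i) \<le> 3 * k + 3"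
    proof
      fix i assume "i \<in> {N..<N'}"
      then consider "i = N" | "i = Suc N" | "i \<in> {Suc (Suc N)..<N'}" by fastforce
      then show "B' i \<subseteq> label_gates F S \<union> scd_gates F t \<and> card (B' i) \<le> 3 * k + 3"
        using B' XY cards *(3) by cases blast+
    qed
    have "label_gates F S \<subseteq> B' N"
      using front(2) B' by (auto simp: X_def label_gates_def front_gates_def)
    then have "label_gates F S \<subseteq> (\<Union>i<N'. B' i)"
      using B'(3) by (intro subset_trans[OF _ UN_upper[of N]]) auto
    then show "label_gates F S \<union> scd_gates F t \<subseteq> (\<Union>i<N'. B' i)"
      by (intro Un_least *(4))
    have S12: "front_gates F S1 \<union> front_gates F S2 \<subseteq> Y"
      using t by (auto simp: Y_def node_front_def)
    have X_chain: "in_entry F S \<in> X" "in_exit F S \<in> X"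
      using front(2) by (auto simp: X_def front_gates_def)
    have Y_new: "oand S \<in> Y" "oor S \<in> Y" "in_exit F S \<in> Y"
      by (auto simp: Y_def)
    show "\<forall>g h. (g, h) \<in> star_wires F (UniteLabels S1 S2 t) c \<longrightarrow> (\<exists>i<N'. g \<in> B' i \<and> h \<in> B' i)"
    proof (intro allI impI)
      fix g h assume "(g, h) \<in> star_wires F (UniteLabels S1 S2 t) c"
      then consider "(g, h) \<in> star_wires F t c" | "g \<in> Y" "h \<in> Y" | "g \<in> X" "h \<in> X"
        using star_wires_Unite[OF S_def S_new(2), of F t c] S12 X_chain Y_new by blast
      then show "\<exists>i<N'. g \<in> B' i \<and> h \<in> B' i"
        using *(5) B' by cases blast+
    qed
  qed
next
  case (AddArcs S1 S2 t)
  have "is_scd t" "\<forall>t' \<in> nodes t. card (labels (node_graph t')) \<le> k" "node_front F t \<subseteq> B r"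
    "scd_gates F t \<inter> (\<Union>i<N. B i) \<subseteq> node_front F t"
    using AddArcs.prems by (auto simp: node_front_simps scd_gates_simps)
  from AddArcs.IH[OF this(1,2) AddArcs.prems(3,4) this(3,4)]
  obtain par' B' where *: "running_intersection (N + 2 * unite_count t) par' B'"
    "\<forall>i<N. B' i = B i"
    "\<forall>i \<in> {N..<N + 2 * unite_count t}. B' i \<subseteq> scd_gates F t \<and> card (B' i) \<le> 3 * k + 3"
    "scd_gates F t \<subseteq> (\<Union>i<N + 2 * unite_count t. B' i)"
    "\<forall>g h. (g, h) \<in> star_wires F t c \<longrightarrow> (\<exists>i<N + 2 * unite_count t. g \<in> B' i \<and> h \<in> B' i)"
    by blast
  \<comment> \<open>Both labels are present at the node, so \<open>B r\<close> already covers every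
    wire that the new arc causes and no bag is added.\<close>
  have "front_gates F S1 \<union> front_gates F S2 \<subseteq> node_front F t"
    using AddArcs.prems(1) by (auto simp: node_front_def)
  then have "front_gates F S1 \<subseteq> B' r" "front_gates F S2 \<subseteq> B' r" "r < N + 2 * unite_count t"
    using *(2) AddArcs.prems(4,5) by (auto simp: node_front_simps)
  then have wires: "\<forall>g h. (g, h) \<in> star_wires F (AddArcs S1 S2 t) c \<longrightarrow> (\<exists>i<N + 2 * unite_count t. g \<in> B' i \<and> h \<in> B' i)"
    using *(5) star_wires_AddArcs[of F S1 S2 t c] by blast
  show ?case
    unfolding scd_gates_simps unite_count.simps by (intro exI conjI) (fact * wires)+
qed

section \<open>From the gates of the decomposition to the circuit \<open>F*\<close>\<close>

lemma star_gates_subset: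
  assumes "scd_of D F"
  shows "pverts (dag (star_circuit F D c)) \<subseteq> scd_gates F D"
proof
  fix g assume "g \<in> pverts (dag (star_circuit F D c))"
  then consider v where "v \<in> pverts (dag F)" "g = Orig v"
    | S where "S \<in> scd_labels D" "\<not> is_singleton S" "g \<in> {OAnd S, OOr S}"
    | S where "S \<in> scd_labels D" "\<not> is_singleton S"
      "g \<in> (if unary_label F S then {InNot1 S, InNot2 S} else {In S})"
    by (fastforce simp: star_circuit_def Let_def new_out_gates_def new_in_gates_def)
  then show "g \<in> scd_gates F D"
  proof cases
    case 1
    \<comment> \<open>Every vertex enters \<open>D\<close> as a singleton label, and the gates of
      that label are the original gate itself.\<close>
    then have "{v} \<in> scd_labels D"
      using assms by (intro singleton_in_scd_labels) (simp add: scd_of_def)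
    then show ?thesis
      using 1 by (auto simp: scd_gates_def label_gates_def oand_def intro!: bexI[of _ "{v}"])
  next
    case (2 S)
    then show ?thesis
      by (auto simp: scd_gates_def label_gates_def oand_def oor_def intro!: bexI[of _ S])
  next
    case (3 S)
    then show ?thesis
      by (auto simp: scd_gates_def label_gates_def in_entry_def in_exit_def split: if_splits
          intro!: bexI[of _ S])
  qed
qed

theorem theorem3:
  fixes F :: "('a, 'v) circuit" and D :: "'a scd" and k :: nat
    and c :: "'a set \<Rightarrow> 'a set \<Rightarrow> bool"
  assumes "boolean_circuit F"
    and "scd_of D F"
    and "type_respecting F D"
    and "scd_width D = k"
  shows "\<exists>(T :: nat pair_pre_digraph) B.
    tree_decomposition (mk_symmetric (with_proj (dag (star_circuit F D c)))) T B \<and>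
    card (pverts T) \<le> 2 * circuit_size F \<and>
    decomposition_width T B \<le> 3 * k + 2"
proof -
  let ?H = "mk_symmetric (with_proj (dag (star_circuit F D c)))"
  let ?V = "pverts (dag (star_circuit F D c))"
  \<comment> \<open>The root bag and two bags for each unite node.\<close>
  define N where "N = 1 + 2 * unite_count D"
  have scd: "is_scd D" "unlabeled (node_graph D) = dag F" using assms(2) by (auto simp: scd_of_def)
  have k: "\<forall>t \<in> nodes D. card (labels (node_graph t)) \<le> k"
    using assms(4) finite_nodes[of D] by (auto simp: scd_width_def intro!: Max_ge)
  \<comment> \<open>The growth starts from a single bag, the front of the root of \<open>D\<close>,
    for which the invariant is trivial.\<close>
  have "running_intersection 1 id (\<lambda>_. node_front F D)"
    "scd_gates F D \<inter> (\<Union>i<1::nat. node_front F D) \<subseteq> node_front F D"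
    by (auto simp: running_intersection_def)
  from scd_decomposition_extension[OF scd(1) k this(1) zero_less_one order_refl this(2), of c,
      folded N_def]
  obtain par B where *: "running_intersection N par B" "B 0 = node_front F D"
    "\<forall>i \<in> {1..<N}. B i \<subseteq> scd_gates F D \<and> card (B i) \<le> 3 * k + 3"
    "scd_gates F D \<subseteq> (\<Union>i<N. B i)"
    "\<forall>g h. (g, h) \<in> star_wires F D c \<longrightarrow> (\<exists>i<N. g \<in> B i \<and> h \<in> B i)"
    by auto
  \<comment> \<open>Bag 0 was supplied rather than built, so its size is bounded separately.\<close>
  have "card (node_front F D) \<le> 3 * k + 3"
    using card_node_front[of F D] k self_in_nodes[of D] by fastforce
  then have bags: "finite (B i) \<and> card (B i) \<le> 3 * k + 3" if "i < N" for i
    using *(2,3) that node_front_subset[of F D] finite_subset[OF _ finite_scd_gates[of F D], of "B i"]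
    by (cases "i = 0") auto
  \<comment> \<open>Gates that were removed, or never created, are discarded from all bags.\<close>
  let ?B = "\<lambda>i. B i \<inter> ?V"
  have "tree_decomposition ?H (parent_tree N par) ?B"
  proof (rule tree_decomposition_running_intersection)
    show "running_intersection N par ?B" by (rule running_intersection_restrict[OF *(1)])
    show "(\<Union>i<N. ?B i) = pverts ?H"
      using star_gates_subset[OF assms(2), of c] *(4) by auto
    fix u v assume "(u, v) \<in> parcs ?H"
    \<comment> \<open>A bag covering a wire covers its reversal as well.\<close>
    then have "(u, v) \<in> star_wires F D c \<union> (star_wires F D c)\<inverse>" "u \<in> ?V" "v \<in> ?V"
      by (auto simp: parcs_mk_symmetric star_circuit_def Let_def)
    then show "\<exists>i<N. u \<in> ?B i \<and> v \<in> ?B i" using *(5) by blast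
  qed (use bags in auto)
  moreover have "pverts (parent_tree N par) = {..<N}" by (simp add: parent_tree_def)
  moreover have "N \<le> 2 * circuit_size F"
  proof -
    \<comment> \<open>At least one label remains at the root, so there are fewer unite nodes than
      gates; this pays for the root bag.\<close>
    have "card (labels (node_graph D)) > 0"
      using labels_nonempty[of D] finite_labels[of D] by (simp add: card_gt_0_iff)
    then show ?thesis using unite_count_bound[OF scd(1)] scd(2) by (simp add: N_def circuit_size_def)
  qed
  \<comment> \<open>The width is one less than the largest bag size, which gives
    \<open>3 * k + 2\<close>.\<close>
  moreover have "Max ((\<lambda>i. card (?B i)) ` {..<N}) \<le> 3 * k + 3"
  proof (rule Max.boundedI)
    fix x assume "x \<in> (\<lambda>i. card (?B i)) ` {..<N}"
    then obtain i where "i < N" "x = card (?B i)" by auto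
    moreover from this have "card (?B i) \<le> card (B i)" using bags by (intro card_mono) auto
    ultimately show "x \<le> 3 * k + 3" using bags[of i] by simp
  qed (auto simp: N_def)
  ultimately show ?thesis
    by (intro exI[of _ "parent_tree N par"] exI[of _ ?B]) (auto simp: decomposition_width_def)
qed

end
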